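(* Let $\mathcal{A},\mathcal{B}\in\mathbb{C}^{I(N)\times I(N)}$ be core tensors with $\mathcal{A}*_N\mathcal{B}=\mathcal{O}$ and $\mathcal{A}^**_N\mathcal{B}=\mathcal{O}$. Then $$(\mathcal{A}+\mathcal{B})^{\mathrm{core}}=(\mathcal{I}-\mathcal{B}^{\mathrm{core}}*_N\mathcal{B})*_N\mathcal{A}^{\mathrm{core}}+\mathcal{B}^{\mathrm{core}}.$$
   Context: Let $I_1,\dots,I_N$ be positive integers. $\mathbb{C}^{I(N)\times I(N)}$ denotes the set of complex tensors of order $2N$ with entries $\mathcal{A}_{i_1\dots i_N j_1\dots j_N}$, where $1\le i_k,j_k\le I_k$; sums are entrywise. The Einstein product is $(\mathcal{A}*_N\mathcal{B})_{i_1\dots i_N j_1\dots j_N}=\sum_{k_1,\dots,k_N}\mathcal{A}_{i_1\dots i_N k_1\dots k_N}\mathcal{B}_{k_1\dots k_N j_1\dots j_N}$, and powers $\mathcal{A}^p$ are taken with respect to $*_N$. The conjugate transpose $\mathcal{A}^*$ is defined by $(\mathcal{A}^* )_{j_1\dots j_N i_1\dots i_N}=\overline{\mathcal{A}_{i_1\dots i_N j_1\dots j_N}}$. $\mathcal{O}$ is the zero tensor and $\mathcal{I}$ is the identity tensor, with entries $\prod_{k=1}^N\delta_{i_kj_k}$. The reshaping $\mathrm{rsh}(\mathcal{A})$ is the square matrix of size $I_1\cdots I_N$ obtained by listing the row multi-indices $(i_1,\dots,i_N)$ and the column multi-indices $(j_1,\dots,j_N)$ in the column-major order of Matlab's reshape;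 $\mathrm{rshrank}(\mathcal{A})$ is the rank of $\mathrm{rsh}(\mathcal{A})$. $\mathcal{A}$ is a core tensor if $\mathrm{rshrank}(\mathcal{A})=\mathrm{rshrank}(\mathcal{A}^2)$. The core inverse $\mathcal{A}^{\mathrm{core}}$ of $\mathcal{A}$ (which exists for core tensors) is the unique $\mathcal{X}$ with $\mathcal{X}*_N\mathcal{A}^2=\mathcal{A}$, $\mathcal{A}*_N\mathcal{X}^2=\mathcal{X}$, $(\mathcal{A}*_N\mathcal{X})^*=\mathcal{A}*_N\mathcal{X}$. *)

theory Defs
  imports "HOL-Library.Function_Algebras" "Jordan_Normal_Form.DL_Rank"
begin

text \<open>
  A list \<open>I = [I\<^sub>1, \<dots>, I\<^sub>N]\<close> is the shape of the tensors. Multi-indices are lists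
  \<open>[i\<^sub>1, \<dots>, i\<^sub>N]\<close> with entries counted from 1, so list position \<open>k\<close> carries the
  index of mode \<open>k + 1\<close>.
\<close>

definition multi_idx :: "nat list \<Rightarrow> nat list set" where
  "multi_idx I = {i. length i = length I \<and> (\<forall>k < length I. 1 \<le> i ! k \<and> i ! k \<le> I ! k)}"

text \<open>
  A tensor of order \<open>2N\<close> takes a row and a column multi-index. Members of \<open>tensors I\<close> are
  zero outside the valid multi-indices, so that equality in HOL is entrywise equality.
  Sum, difference and zero tensor are the pointwise ones of \<open>Function_Algebras\<close>;
  the pointwise product and power of that theory are not used.
\<close>

type_synonym tensor = "nat list \<Rightarrow> nat list \<Rightarrow> complex"

definition tensors :: "nat list \<Rightarrow> tensor set" where
  "tensors I = {A. \<forall>i j. \<not> (i \<in> multi_idx I \<and> j \<in> multi_idx I) \<longrightarrow> A i j = 0}"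

definition einstein :: "tensor \<Rightarrow> nat list \<Rightarrow> tensor \<Rightarrow> tensor"
    ("(_ \<star>\<^bsub>_\<^esub> _)" [71, 0, 70] 70) where
  "A \<star>\<^bsub>I\<^esub> B = (\<lambda>i j. \<Sum>k \<in> multi_idx I. A i k * B k j)"

definition tid :: "nat list \<Rightarrow> tensor" where
  "tid I = (\<lambda>i j. if i \<in> multi_idx I \<and> j \<in> multi_idx I
     then (\<Prod>k < length I. if i ! k = j ! k then 1 else 0) else 0)"

primrec tpow :: "nat list \<Rightarrow> tensor \<Rightarrow> nat \<Rightarrow> tensor" where
  "tpow I A 0 = tid I"
| "tpow I A (Suc p) = A \<star>\<^bsub>I\<^esub> tpow I A p"

definition ctrans :: "tensor \<Rightarrow> tensor" where
  "ctrans A = (\<lambda>j i. cnj (A i j))"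

text \<open>
  The position, counted from 0, of a multi-index in the column-major order:
  \<open>(i\<^sub>1 - 1) + I\<^sub>1 * ((i\<^sub>2 - 1) + I\<^sub>2 * ((i\<^sub>3 - 1) + \<dots>))\<close>; the first index varies fastest.
\<close>

fun colmajor :: "nat list \<Rightarrow> nat list \<Rightarrow> nat" where
  "colmajor (d # I) (a # i) = (a - 1) + d * colmajor I i"
| "colmajor _ _ = 0"

definition rsh :: "nat list \<Rightarrow> tensor \<Rightarrow> complex mat" where
  "rsh I A = mat (prod_list I) (prod_list I)
     (\<lambda>(r, c). A (inv_into (multi_idx I) (colmajor I) r) (inv_into (multi_idx I) (colmajor I) c))"

definition rshrank :: "nat list \<Rightarrow> tensor \<Rightarrow> nat" where
  "rshrank I A = vec_space.rank (prod_list I) (rsh I A)"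

definition core_tensor :: "nat list \<Rightarrow> tensor \<Rightarrow> bool" where
  "core_tensor I A \<longleftrightarrow> rshrank I A = rshrank I (tpow I A 2)"

text \<open>Only meaningful for core tensors; unspecified otherwise.\<close>

definition core_inverse :: "nat list \<Rightarrow> tensor \<Rightarrow> tensor" where
  "core_inverse I A = (THE X. X \<in> tensors I \<and>
     X \<star>\<^bsub>I\<^esub> tpow I A 2 = A \<and>
     A \<star>\<^bsub>I\<^esub> tpow I X 2 = X \<and>
     ctrans (A \<star>\<^bsub>I\<^esub> X) = A \<star>\<^bsub>I\<^esub> X)"

text \<open>The order is a bijection onto the matrix indices, so \<open>rsh\<close> has the intended entries.\<close>

lemma multi_idx_Nil: "multi_idx [] = {[]}"
  by (auto simp: multi_idx_def)

lemma multi_idx_Cons: "multi_idx (d # I) = (\<lambda>(a, i). a # i) ` ({1..d} \<times> multi_idx I)"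
proof -
  have "i \<in> multi_idx (d # I) \<longleftrightarrow> i \<in> (\<lambda>(a, i). a # i) ` ({1..d} \<times> multi_idx I)" for i
    by (cases i) (auto simp: multi_idx_def less_Suc_eq_0_disj image_iff)
  then show ?thesis by blast
qed

lemma bij_betw_colmajor: "bij_betw (colmajor I) (multi_idx I) {..<prod_list I}"
proof (induction I)
  case Nil
  then show ?case by (simp add: multi_idx_Nil bij_betw_def lessThan_Suc)
next
  case (Cons d I)
  have inj: "inj_on (colmajor (d # I)) (multi_idx (d # I))"
  proof (rule inj_onI)
    fix x y assume "x \<in> multi_idx (d # I)" "y \<in> multi_idx (d # I)"
      and eq: "colmajor (d # I) x = colmajor (d # I) y"
    then obtain a i b j where x: "x = a # i" "1 \<le> a" "a \<le> d" "i \<in> multi_idx I"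
      and y: "y = b # j" "1 \<le> b" "b \<le> d" "j \<in> multi_idx I"
      by (auto simp: multi_idx_Cons)
    have eq': "(a - 1) + d * colmajor I i = (b - 1) + d * colmajor I j"
      using eq x y by simp
    have d: "a - 1 < d" "b - 1 < d" using x y by auto
    from eq' have "((a - 1) + d * colmajor I i) mod d = ((b - 1) + d * colmajor I j) mod d"
      by simp
    then have ab: "a - 1 = b - 1" using d by simp
    with eq' d have "colmajor I i = colmajor I j" by simp
    then have "i = j" using Cons x y by (auto simp: bij_betw_def inj_on_def)
    with ab x y show "x = y" by auto
  qed
  have "colmajor (d # I) ` multi_idx (d # I) = {..<d * prod_list I}"
  proof (intro Set.set_eqI iffI)
    fix r assume "r \<in> colmajor (d # I) ` multi_idx (d # I)"
    then obtain a i where r: "r = (a - 1) + d * colmajor I i" "1 \<le> a" "a \<le> d" "i \<in> multi_idx I"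
      by (auto simp: multi_idx_Cons)
    then have "colmajor I i < prod_list I" using Cons by (auto simp: bij_betw_def)
    then have "d * Suc (colmajor I i) \<le> d * prod_list I"
      by (intro mult_le_mono2) simp
    with r show "r \<in> {..<d * prod_list I}" by simp
  next
    fix r assume r: "r \<in> {..<d * prod_list I}"
    then have d: "d > 0" by (cases d) auto
    have "r div d < prod_list I"
      using r by (auto intro: less_mult_imp_div_less simp: mult.commute)
    then obtain i where i: "i \<in> multi_idx I" "colmajor I i = r div d"
      using Cons unfolding bij_betw_def by (metis imageE lessThan_iff)
    have "r = colmajor (d # I) (Suc (r mod d) # i)" using i by simp
    moreover have "Suc (r mod d) # i \<in> multi_idx (d # I)"
      using i d by (auto simp: multi_idx_Cons Suc_le_eq)
    ultimately show "r \<in> colmajor (d # I) ` multi_idx (d # I)" by blast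
  qed
  with inj show ?case by (simp add: bij_betw_def)
qed

lemma rsh_colmajor:
  assumes "i \<in> multi_idx I" and "j \<in> multi_idx I"
  shows "rsh I A $$ (colmajor I i, colmajor I j) = A i j"
proof -
  have inj: "inj_on (colmajor I) (multi_idx I)"
    and "colmajor I i < prod_list I" "colmajor I j < prod_list I"
    using bij_betw_colmajor[of I] assms by (auto simp: bij_betw_def)
  then show ?thesis using assms by (simp add: rsh_def inv_into_f_f)
qed

end

theory Submission
  imports Defs
begin

text \<open>
  Being a core tensor is equivalent to having a core inverse \<open>X\<close>. For existence, equality of the
  ranks of \<open>A\<close> and \<open>A\<^sup>2\<close> gives \<open>A = A\<^sup>2W\<close>, hence also \<open>A = RA\<^sup>2\<close>, and \<open>X = RAL\<close> works for any
  \<open>L\<close> such that \<open>ALA = A\<close> and \<open>AL\<close> is Hermitian. If \<open>X\<close> and \<open>Y\<close> are the core inverses of \<open>A\<close>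
  and \<open>B\<close>, then \<open>AB = 0\<close> and \<open>A\<^sup>*B = 0\<close> yield \<open>AY = YA = XB = XY = YX = 0\<close>, and the defining
  equations of the core inverse of \<open>A + B\<close> follow by expanding the products.
\<close>

section \<open>Inner inverses of matrices\<close>

text \<open>In the reduced row echelon form \<open>C = P A\<close> the pivot columns are unit
  vectors. If \<open>G\<close> selects them, \<open>C G\<close> is the diagonal projector onto the
  nonzero rows of \<open>C\<close>, so \<open>C G C = C\<close>; undoing the invertible
  \<open>P\<close> makes \<open>G P\<close> an inner inverse of \<open>A\<close>.\<close>

lemma mat_inner_inverse:
  fixes A :: "'a :: field mat"
  assumes A: "A \<in> carrier_mat n m"
  shows "\<exists>G \<in> carrier_mat m n. A * (G * A) = A"
proof -
  define C where "C = gauss_jordan_single A"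
  note gj = gauss_jordan_single[OF A C_def[symmetric]]
  have C: "C \<in> carrier_mat n m" by (rule gj)
  from gj(4) obtain P Q where CPA: "C = P * A" and P: "P \<in> carrier_mat n n"
    and Q: "Q \<in> carrier_mat n n" and QP: "Q * P = 1\<^sub>m n" by blast
  from gj(3) C obtain f where "pivot_fun C f m" by (auto simp: row_echelon_form_def)
  note piv = pivot_funD[OF carrier_matD(1)[OF C] this]
  \<comment> \<open>\<open>f i\<close> is the pivot column of row \<open>i\<close>; it equals
    \<open>m\<close> for a zero row, and column \<open>i\<close> of \<open>G\<close> is then
    zero.\<close>
  define G where "G = mat m n (\<lambda>(j, i). if f i = j then 1 else 0 :: 'a)"
  have G: "G \<in> carrier_mat m n" by (simp add: G_def)
  have CG: "(C * G) $$ (i, k) = (if i = k \<and> f i < m then 1 else 0)" if "i < n" "k < n" for i k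
  proof -
    have "(C * G) $$ (i, k) = (\<Sum>j<m. C $$ (i, j) * (if f k = j then 1 else 0))"
      using that C by (auto simp: G_def scalar_prod_def atLeast0LessThan intro!: sum.cong)
    also have "\<dots> = (\<Sum>j<m. if f k = j then C $$ (i, j) else 0)"
      by (rule sum.cong) auto
    also have "\<dots> = (if f k < m then C $$ (i, f k) else 0)" by simp
    finally show ?thesis using piv(4,5) that by auto
  qed
  define D where "D = C * G"
  have D: "D \<in> carrier_mat n n" using C G by (simp add: D_def)
  have "D * C = C"
  proof (rule eq_matI)
    fix i j assume "i < dim_row C" "j < dim_col C"
    then have ij: "i < n" "j < m" using C by auto
    have "(D * C) $$ (i, j) = (\<Sum>k<n. D $$ (i, k) * C $$ (k, j))"
      using ij C D by (auto simp: scalar_prod_def atLeast0LessThan)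
    also have "\<dots> = (\<Sum>k<n. if i = k then (if f i < m then C $$ (i, j) else 0) else 0)"
      using ij by (intro sum.cong) (auto simp: CG D_def)
    also have "\<dots> = (if f i < m then C $$ (i, j) else 0)" using ij by simp
    \<comment> \<open>If \<open>f i\<close> is not below \<open>m\<close>, it equals
      \<open>m\<close>; all entries of row \<open>i\<close> then lie left of the pivot position and
      vanish.\<close>
    also have "\<dots> = C $$ (i, j)"
      using piv(1)[OF ij(1)] piv(2)[OF ij(1), of j] ij by auto
    finally show "(D * C) $$ (i, j) = C $$ (i, j)" .
  qed (use C D in auto)
  then have CGC: "C * (G * C) = C" using C G by (simp add: D_def)
  have QC: "Q * C = A" using A P Q by (simp add: CPA QP flip: assoc_mult_mat)
  \<comment> \<open>\<open>A\<close> becomes \<open>Q C\<close> on the left and \<open>P A\<close>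
    becomes \<open>C\<close> on the right, which reduces the claim to \<open>CGC\<close>.\<close>
  have "A * ((G * P) * A) = (Q * C) * (G * C)"
    using A G P by (simp add: QC flip: CPA)
  also have "\<dots> = Q * (C * (G * C))"
    using C G Q by (intro assoc_mult_mat) auto
  finally have "A * ((G * P) * A) = A" by (simp only: CGC QC)
  with G P show ?thesis by (intro bexI[of _ "G * P"]) auto
qed

section \<open>Column spaces and ranks of matrix products\<close>

context vec_space
begin

lemma col_space_mult_subset:
  assumes A: "A \<in> carrier_mat n m" and B: "B \<in> carrier_mat m k"
  shows "col_space (A * B) \<subseteq> col_space A"
  using A B by (force simp: col_space_eq[OF A] col_space_eq[OF mult_carrier_mat[OF A B]])

text \<open>A maximal independent set \<open>S\<close> of columns of \<open>A * B\<close> has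
  \<open>rank (A * B)\<close> elements and lies in the column space of \<open>A\<close>, so its size
  is at most \<open>rank A\<close>. At equality \<open>S\<close> is a basis of that space, and both
  column spaces are the span of \<open>S\<close>.\<close>

lemma
  assumes A: "A \<in> carrier_mat n m" and B: "B \<in> carrier_mat m k"
  shows rank_mult_le: "rank (A * B) \<le> rank A"
    and col_space_mult_eq: "rank (A * B) = rank A \<Longrightarrow> col_space (A * B) = col_space A"
proof -
  let ?V = "span_vs (set (cols A))"
  have AB: "A * B \<in> carrier_mat n k" using A B by simp
  have cA: "set (cols A) \<subseteq> carrier_vec n" and cAB: "set (cols (A * B)) \<subseteq> carrier_vec n"
    using cols_dim A AB by blast+
  have sub: "submodule class_ring (span (set (cols A))) V" by (rule span_is_submodule[OF cA])
  interpret W: vectorspace class_ring ?V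
    by (rule subspace_is_vs) (simp add: cA span_is_subspace)
  have fd: "W.fin_dim" by (rule fin_dim_span_cols[OF A])
  obtain S where S: "finite S" "maximal S (\<lambda>T. T \<subseteq> set (cols (A * B)) \<and> lin_indpt T)"
    using maximal_exists_superset[of "set (cols (A * B))"
        "\<lambda>T. T \<subseteq> set (cols (A * B)) \<and> lin_indpt T" "{}"]
    by (auto simp: lin_dep_def)
  have rk: "rank (A * B) = card S" by (rule rank_card_indpt[OF AB S(2)])
  have S': "S \<subseteq> set (cols (A * B))" "lin_indpt S" using S(2) by (auto simp: maximal_def)
  have SA: "S \<subseteq> span (set (cols A))"
    using S'(1) in_own_span[OF cAB] col_space_mult_subset[OF A B] by (auto simp: col_space_def)
  \<comment> \<open>Independence and span of \<open>S\<close> agree in \<open>V\<close> and in the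
    subspace \<open>?V\<close>, so dimension results for \<open>?V\<close> apply to
    \<open>S\<close>.\<close>
  note nd = span_li_not_depend[OF SA sub]
  have li: "W.lin_indpt S" using nd(2) S'(2) by simp
  have rkA: "rank A = W.dim" by (simp add: rank_def)
  show "rank (A * B) \<le> rank A"
    using W.li_le_dim(2)[OF fd _ li] SA by (simp add: rk rkA)
  assume "rank (A * B) = rank A"
  then have "W.basis S"
    using W.dim_li_is_basis[OF fd S(1) _ li] SA by (simp add: rk rkA)
  then have "span S = span (set (cols A))"
    using nd(1) by (simp add: W.basis_def)
  then have "col_space A \<subseteq> col_space (A * B)"
    using span_is_monotone[OF S'(1)] by (simp add: col_space_def)
  then show "col_space (A * B) = col_space A" using col_space_mult_subset[OF A B] by blast
qed

text \<open>Equal ranks put every column of \<open>A\<close> into the column space of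
  \<open>A * B\<close>; preimages of these columns, set side by side, form \<open>W\<close>.\<close>

lemma rank_mult_eq_imp_factor:
  assumes A: "A \<in> carrier_mat n m" and B: "B \<in> carrier_mat m k"
    and rank: "rank (A * B) = rank A"
  shows "\<exists>W \<in> carrier_mat k m. (A * B) * W = A"
proof -
  have AB: "A * B \<in> carrier_mat n k" using A B by simp
  have "\<exists>x \<in> carrier_vec k. (A * B) *\<^sub>v x = col A j" if "j < m" for j
  proof -
    have "col A j \<in> set (cols A)" using that A by (auto simp: cols_def)
    moreover have "set (cols A) \<subseteq> carrier_vec n" using cols_dim A by blast
    ultimately have "col A j \<in> col_space (A * B)"
      unfolding col_space_mult_eq[OF A B rank] unfolding col_space_def using in_own_span by blast
    then show ?thesis using AB B by (auto simp: col_space_eq[OF AB])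
  qed
  then obtain x where x: "\<And>j. j < m \<Longrightarrow> x j \<in> carrier_vec k \<and> (A * B) *\<^sub>v x j = col A j" by metis
  define W where "W = mat_of_cols k (map x [0..<m])"
  have W: "W \<in> carrier_mat k m" by (auto simp: W_def)
  have "(A * B) * W = A"
  proof (rule mat_col_eqI)
    fix j assume "j < dim_col A"
    then have j: "j < m" using A by simp
    have "col W j = x j" using x[OF j] j by (simp add: W_def)
    then show "col (A * B * W) j = col A j" using x[OF j] by (simp only: col_mult2[OF AB W j])
  qed (use A W in auto)
  with W show ?thesis by blast
qed

end

section \<open>Algebra of tensors under the Einstein product\<close>

lemma finite_multi_idx [simp]: "finite (multi_idx I)"
  using bij_betw_finite[OF bij_betw_colmajor[of I]] by simp

lemma tensors_closed [simp, intro]: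
  shows "0 \<in> tensors I" and "tid I \<in> tensors I"
    and "A \<in> tensors I \<Longrightarrow> ctrans A \<in> tensors I"
    and "A \<in> tensors I \<Longrightarrow> B \<in> tensors I \<Longrightarrow> A + B \<in> tensors I"
    and "A \<in> tensors I \<Longrightarrow> B \<in> tensors I \<Longrightarrow> A - B \<in> tensors I"
    and "A \<in> tensors I \<Longrightarrow> B \<in> tensors I \<Longrightarrow> A \<star>\<^bsub>I\<^esub> B \<in> tensors I"
  by (auto simp: tensors_def ctrans_def tid_def einstein_def)

lemma tid_eq: "tid I i j = (if i = j \<and> i \<in> multi_idx I then 1 else 0)"
proof -
  have "(\<exists>k < length I. i ! k \<noteq> j ! k) \<longleftrightarrow> i \<noteq> j" if "i \<in> multi_idx I" "j \<in> multi_idx I"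
    using that by (auto simp: multi_idx_def list_eq_iff_nth_eq)
  then show ?thesis by (auto simp: tid_def prod_zero_iff)
qed

lemma einstein_assoc: "(A \<star>\<^bsub>I\<^esub> B) \<star>\<^bsub>I\<^esub> C = A \<star>\<^bsub>I\<^esub> (B \<star>\<^bsub>I\<^esub> C)"
  by (intro ext) (auto simp: einstein_def sum_distrib_left sum_distrib_right mult.assoc
      intro: sum.swap)

lemma einstein_linear:
  shows "(A + B) \<star>\<^bsub>I\<^esub> C = A \<star>\<^bsub>I\<^esub> C + B \<star>\<^bsub>I\<^esub> C"
    and "(A - B) \<star>\<^bsub>I\<^esub> C = A \<star>\<^bsub>I\<^esub> C - B \<star>\<^bsub>I\<^esub> C"
    and "C \<star>\<^bsub>I\<^esub> (A + B) = C \<star>\<^bsub>I\<^esub> A + C \<star>\<^bsub>I\<^esub> B"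
    and "C \<star>\<^bsub>I\<^esub> (A - B) = C \<star>\<^bsub>I\<^esub> A - C \<star>\<^bsub>I\<^esub> B"
  by (auto simp: einstein_def fun_eq_iff algebra_simps sum.distrib sum_subtractf)

lemma einstein_zero [simp]: "0 \<star>\<^bsub>I\<^esub> A = 0" "A \<star>\<^bsub>I\<^esub> 0 = 0"
  by (auto simp: einstein_def fun_eq_iff)

lemma einstein_tid [simp]:
  assumes "A \<in> tensors I"
  shows "tid I \<star>\<^bsub>I\<^esub> A = A" and "A \<star>\<^bsub>I\<^esub> tid I = A"
proof -
  have "(\<Sum>k\<in>multi_idx I. tid I i k * A k j) = (\<Sum>k\<in>multi_idx I. if k = i then A k j else 0)"
    and "(\<Sum>k\<in>multi_idx I. A i k * tid I k j) = (\<Sum>k\<in>multi_idx I. if k = j then A i k else 0)"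
    for i j by (intro sum.cong; auto simp: tid_eq)+
  then show "tid I \<star>\<^bsub>I\<^esub> A = A" "A \<star>\<^bsub>I\<^esub> tid I = A"
    unfolding einstein_def using assms by (auto simp: fun_eq_iff tensors_def)
qed

lemma tpow_2: "A \<in> tensors I \<Longrightarrow> tpow I A 2 = A \<star>\<^bsub>I\<^esub> A"
  by (simp add: numeral_2_eq_2)

lemma ctrans_simps [simp]:
  shows "ctrans (ctrans A) = A" and "ctrans 0 = 0"
    and "ctrans (A \<star>\<^bsub>I\<^esub> B) = ctrans B \<star>\<^bsub>I\<^esub> ctrans A"
    and "ctrans (A + B) = ctrans A + ctrans B"
  by (auto simp: ctrans_def einstein_def fun_eq_iff mult.commute)

text \<open>The diagonal entry of the product at \<open>j\<close> is the sum of the squared moduli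
  in column \<open>j\<close> of \<open>M\<close> over the valid rows. The rows that this sum does
  not reach vanish by membership in \<open>tensors I\<close>.\<close>

lemma ctrans_einstein_self_eq_0:
  assumes M: "M \<in> tensors I" and 0: "ctrans M \<star>\<^bsub>I\<^esub> M = 0"
  shows "M = 0"
proof -
  have "M k j = 0" if "k \<in> multi_idx I" for k j
  proof -
    have "(ctrans M \<star>\<^bsub>I\<^esub> M) j j = of_real (\<Sum>k\<in>multi_idx I. (cmod (M k j))\<^sup>2)"
      by (simp add: einstein_def ctrans_def complex_norm_square mult.commute del: of_real_power)
    then have "(\<Sum>k\<in>multi_idx I. (cmod (M k j))\<^sup>2) = 0"
      unfolding 0 zero_fun_apply by (metis of_real_eq_0_iff)
    with that show ?thesis by (simp add: sum_nonneg_eq_0_iff)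
  qed
  moreover have "M k j = 0" if "k \<notin> multi_idx I" for k j
    using M that by (auto simp: tensors_def)
  ultimately show ?thesis by (auto simp: fun_eq_iff)
qed

section \<open>Correspondence between tensors and matrices\<close>

text \<open>Inverse of \<open>rsh I\<close> on \<open>tensors I\<close>, used to turn matrices found
  by linear algebra into tensor witnesses. The default value 0 keeps the result in
  \<open>tensors I\<close>.\<close>

definition unrsh :: "nat list \<Rightarrow> complex mat \<Rightarrow> tensor" where
  "unrsh I M = (\<lambda>i j. if i \<in> multi_idx I \<and> j \<in> multi_idx I
     then M $$ (colmajor I i, colmajor I j) else 0)"

lemma rsh_carrier [simp]: "rsh I A \<in> carrier_mat (prod_list I) (prod_list I)"
  by (simp add: rsh_def)

lemma unrsh_tensors [simp]: "unrsh I M \<in> tensors I"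
  by (auto simp: unrsh_def tensors_def)

lemma unrsh_rsh: "A \<in> tensors I \<Longrightarrow> unrsh I (rsh I A) = A"
  by (auto simp: unrsh_def tensors_def fun_eq_iff rsh_colmajor)

lemma bij_betw_inv_colmajor:
  "bij_betw (inv_into (multi_idx I) (colmajor I)) {0..<prod_list I} (multi_idx I)"
  using bij_betw_inv_into[OF bij_betw_colmajor] by (simp add: atLeast0LessThan)

lemma rsh_unrsh:
  assumes "M \<in> carrier_mat (prod_list I) (prod_list I)"
  shows "rsh I (unrsh I M) = M"
proof -
  have "inv_into (multi_idx I) (colmajor I) r \<in> multi_idx I"
    and "colmajor I (inv_into (multi_idx I) (colmajor I) r) = r" if "r < prod_list I" for r
    using that bij_betw_colmajor[of I] bij_betwE[OF bij_betw_inv_colmajor[of I]]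
    by (auto simp: bij_betw_inv_into_right)
  then show ?thesis using assms by (intro eq_matI) (auto simp: rsh_def unrsh_def)
qed

text \<open>The sum over multi-indices is reindexed along the inverse of \<open>colmajor I\<close>,
  a bijection from the matrix indices.\<close>

lemma rsh_einstein: "rsh I (A \<star>\<^bsub>I\<^esub> B) = rsh I A * rsh I B"
  by (rule eq_matI)
    (auto simp: rsh_def einstein_def scalar_prod_def
      simp flip: sum.reindex_bij_betw[OF bij_betw_inv_colmajor])

lemma rsh_tid: "rsh I (tid I) = 1\<^sub>m (prod_list I)"
proof (rule eq_matI)
  fix r c assume rc: "r < dim_row (1\<^sub>m (prod_list I))" "c < dim_col (1\<^sub>m (prod_list I))"
  then have "inv_into (multi_idx I) (colmajor I) r = inv_into (multi_idx I) (colmajor I) c \<longleftrightarrow> r = c"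
    and "inv_into (multi_idx I) (colmajor I) r \<in> multi_idx I"
    using bij_betw_inv_colmajor[of I] by (auto simp: bij_betw_def inj_on_eq_iff)
  with rc show "rsh I (tid I) $$ (r, c) = 1\<^sub>m (prod_list I) $$ (r, c)"
    by (simp add: rsh_def tid_eq)
qed (simp_all add: rsh_def)

lemma tensor_eqI:
  "A \<in> tensors I \<Longrightarrow> B \<in> tensors I \<Longrightarrow> rsh I A = rsh I B \<Longrightarrow> A = B"
  by (metis unrsh_rsh)

text \<open>Reshaping gives square matrices, for which a one-sided inverse is two-sided.\<close>

lemma einstein_inverse_commute:
  assumes "A \<in> tensors I" and "B \<in> tensors I" and "A \<star>\<^bsub>I\<^esub> B = tid I"
  shows "B \<star>\<^bsub>I\<^esub> A = tid I"
proof (rule tensor_eqI)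
  have "rsh I A * rsh I B = 1\<^sub>m (prod_list I)"
    using assms(3) by (metis rsh_einstein rsh_tid)
  then show "rsh I (B \<star>\<^bsub>I\<^esub> A) = rsh I (tid I)"
    by (simp add: rsh_einstein rsh_tid mat_mult_left_right_inverse[of _ "prod_list I"])
qed (use assms in auto)

section \<open>Inner inverses and factorizations of tensors\<close>

lemma tensor_inner_inverse:
  assumes "A \<in> tensors I"
  shows "\<exists>G \<in> tensors I. A \<star>\<^bsub>I\<^esub> (G \<star>\<^bsub>I\<^esub> A) = A"
proof -
  obtain G where G: "G \<in> carrier_mat (prod_list I) (prod_list I)"
    "rsh I A * (G * rsh I A) = rsh I A"
    using mat_inner_inverse[OF rsh_carrier] by blast
  then have "A \<star>\<^bsub>I\<^esub> (unrsh I G \<star>\<^bsub>I\<^esub> A) = A"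
    using assms by (intro tensor_eqI) (auto simp: rsh_einstein rsh_unrsh)
  then show ?thesis by auto
qed

lemma rshrank_einstein_le: "rshrank I (A \<star>\<^bsub>I\<^esub> B) \<le> rshrank I A"
  by (simp add: rshrank_def rsh_einstein vec_space.rank_mult_le[of _ _ "prod_list I" _ "prod_list I"])

lemma rshrank_eq_imp_factor:
  assumes A: "A \<in> tensors I" and B: "B \<in> tensors I"
    and rank: "rshrank I (A \<star>\<^bsub>I\<^esub> B) = rshrank I A"
  shows "\<exists>W \<in> tensors I. A \<star>\<^bsub>I\<^esub> (B \<star>\<^bsub>I\<^esub> W) = A"
proof -
  have "vec_space.rank (prod_list I) (rsh I A * rsh I B) = vec_space.rank (prod_list I) (rsh I A)"
    using rank by (simp add: rshrank_def rsh_einstein)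
  from vec_space.rank_mult_eq_imp_factor[OF rsh_carrier rsh_carrier this]
  obtain W where W: "W \<in> carrier_mat (prod_list I) (prod_list I)"
    "rsh I A * rsh I B * W = rsh I A" by blast
  then have "(A \<star>\<^bsub>I\<^esub> B) \<star>\<^bsub>I\<^esub> unrsh I W = A"
    using A B by (intro tensor_eqI) (auto simp only: rsh_einstein rsh_unrsh tensors_closed unrsh_tensors)
  then show ?thesis by (auto simp: einstein_assoc)
qed

text \<open>
  The witness is \<open>G \<star> A\<^sup>*\<close> for an inner inverse \<open>G\<close> of \<open>A\<^sup>* \<star> A\<close>; it is an inner inverse of \<open>A\<close>
  because \<open>A\<^sup>*\<close> can be cancelled in \<open>A\<^sup>* \<star> A \<star> Z = 0\<close>.
\<close>

lemma ex_hermitian_inner_inverse: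
  assumes A: "A \<in> tensors I"
  shows "\<exists>L \<in> tensors I. A \<star>\<^bsub>I\<^esub> (L \<star>\<^bsub>I\<^esub> A) = A \<and> ctrans (A \<star>\<^bsub>I\<^esub> L) = A \<star>\<^bsub>I\<^esub> L"
proof -
  let ?H = "ctrans A \<star>\<^bsub>I\<^esub> A"
  obtain G where G: "G \<in> tensors I" "?H \<star>\<^bsub>I\<^esub> (G \<star>\<^bsub>I\<^esub> ?H) = ?H"
    using tensor_inner_inverse[of ?H I] A by auto
  define L where "L = G \<star>\<^bsub>I\<^esub> ctrans A"
  define Z where "Z = L \<star>\<^bsub>I\<^esub> A - tid I"
  have L: "L \<in> tensors I" and Z: "Z \<in> tensors I" using A G by (auto simp: L_def Z_def)
  \<comment> \<open>Expanding \<open>Z\<close> turns the left side into \<open>H G H - H\<close>,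
    where \<open>H\<close> stands for \<open>?H\<close>.\<close>
  have HZ: "ctrans A \<star>\<^bsub>I\<^esub> (A \<star>\<^bsub>I\<^esub> Z) = 0"
    using G A by (simp add: Z_def L_def einstein_linear einstein_assoc)
  have "ctrans (A \<star>\<^bsub>I\<^esub> Z) \<star>\<^bsub>I\<^esub> (A \<star>\<^bsub>I\<^esub> Z) = 0"
    by (simp add: einstein_assoc HZ)
  then have "A \<star>\<^bsub>I\<^esub> Z = 0" by (rule ctrans_einstein_self_eq_0[rotated]) (use A Z in auto)
  then have ALA: "A \<star>\<^bsub>I\<^esub> (L \<star>\<^bsub>I\<^esub> A) = A" using A by (simp add: Z_def einstein_linear)
  have "ctrans A \<star>\<^bsub>I\<^esub> ctrans (A \<star>\<^bsub>I\<^esub> L) = ctrans A"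
    using arg_cong[OF ALA, of ctrans] by (simp add: einstein_assoc)
  \<comment> \<open>Here \<open>A L = A G A^*\<close>, and \<open>A^*\<close> equals
    \<open>A^* (A L)^*\<close>. So \<open>A L\<close> has the form \<open>M M^*\<close> with
    \<open>M = A L\<close>, which is Hermitian.\<close>
  then have P: "A \<star>\<^bsub>I\<^esub> L = (A \<star>\<^bsub>I\<^esub> L) \<star>\<^bsub>I\<^esub> ctrans (A \<star>\<^bsub>I\<^esub> L)"
    by (metis L_def einstein_assoc)
  have "ctrans (A \<star>\<^bsub>I\<^esub> L) = A \<star>\<^bsub>I\<^esub> L"
    by (subst (1 2) P) (simp add: einstein_assoc)
  with L ALA show ?thesis by blast
qed

text \<open>
  The pair \<open>A\<^sup>2G + I - AG\<close> and \<open>AWG + I - AG\<close> is inverse from one side by computation,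
  hence from both sides by finite dimensionality; the former maps \<open>A\<close> to \<open>A\<^sup>2\<close>.
\<close>

lemma square_right_factor_imp_left_factor:
  assumes A: "A \<in> tensors I" and W: "W \<in> tensors I" and AW: "A \<star>\<^bsub>I\<^esub> (A \<star>\<^bsub>I\<^esub> W) = A"
  shows "\<exists>R \<in> tensors I. R \<star>\<^bsub>I\<^esub> (A \<star>\<^bsub>I\<^esub> A) = A"
proof -
  obtain G where G: "G \<in> tensors I" "A \<star>\<^bsub>I\<^esub> (G \<star>\<^bsub>I\<^esub> A) = A"
    using tensor_inner_inverse[OF A] by blast
  define E where "E = A \<star>\<^bsub>I\<^esub> G"
  define U where "U = A \<star>\<^bsub>I\<^esub> E + tid I - E"
  define R where "R = (A \<star>\<^bsub>I\<^esub> W) \<star>\<^bsub>I\<^esub> G + tid I - E"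
  have E: "E \<in> tensors I" and U: "U \<in> tensors I" and R: "R \<in> tensors I"
    using A W G by (auto simp: E_def U_def R_def)
  have EA: "E \<star>\<^bsub>I\<^esub> A = A" using G by (simp add: E_def einstein_assoc)
  have EE: "E \<star>\<^bsub>I\<^esub> E = E" by (metis EA E_def einstein_assoc)
  have UA: "U \<star>\<^bsub>I\<^esub> A = A \<star>\<^bsub>I\<^esub> A"
    using A by (simp add: U_def einstein_linear einstein_assoc EA)
  have UE: "U \<star>\<^bsub>I\<^esub> (tid I - E) = tid I - E"
    using A E by (simp add: U_def einstein_linear einstein_assoc EE)
  \<comment> \<open>Since \<open>U A = A^2\<close>, this product is \<open>A (A W) G = A G\<close>.
    The remaining summand \<open>tid I - E\<close> of \<open>R\<close> is fixed by \<open>U\<close>,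
    and the two add up to the identity.\<close>
  have "U \<star>\<^bsub>I\<^esub> (A \<star>\<^bsub>I\<^esub> (W \<star>\<^bsub>I\<^esub> G)) = E"
    by (metis AW E_def UA einstein_assoc)
  then have "U \<star>\<^bsub>I\<^esub> R = tid I"
    using UE by (simp add: R_def einstein_linear einstein_assoc add_diff_eq[symmetric])
  then have "R \<star>\<^bsub>I\<^esub> U = tid I" by (rule einstein_inverse_commute[OF U R])
  then have "R \<star>\<^bsub>I\<^esub> (A \<star>\<^bsub>I\<^esub> A) = A" by (metis A UA einstein_assoc einstein_tid(1))
  with R show ?thesis by blast
qed

section \<open>Existence and uniqueness of core inverses\<close>

text \<open>The predicate under \<open>THE\<close> in \<open>core_inverse\<close>, with squares
  written as products so that associativity applies directly.\<close>

definition is_core_inverse :: "nat list \<Rightarrow> tensor \<Rightarrow> tensor \<Rightarrow> bool" where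
  "is_core_inverse I A X \<longleftrightarrow> X \<in> tensors I \<and> X \<star>\<^bsub>I\<^esub> (A \<star>\<^bsub>I\<^esub> A) = A \<and>
     A \<star>\<^bsub>I\<^esub> (X \<star>\<^bsub>I\<^esub> X) = X \<and> ctrans (A \<star>\<^bsub>I\<^esub> X) = A \<star>\<^bsub>I\<^esub> X"

text \<open>For the last two equations, \<open>A X A = A X (X A^2) = (A X^2) A^2 = X A^2 = A\<close>
  and \<open>X A X = X A (A X^2) = (X A^2) X^2 = A X^2 = X\<close>.\<close>

lemma is_core_inverseD:
  assumes "is_core_inverse I A X"
  shows "X \<in> tensors I" and "X \<star>\<^bsub>I\<^esub> (A \<star>\<^bsub>I\<^esub> A) = A" and "A \<star>\<^bsub>I\<^esub> (X \<star>\<^bsub>I\<^esub> X) = X"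
    and "ctrans X \<star>\<^bsub>I\<^esub> ctrans A = A \<star>\<^bsub>I\<^esub> X"
    and "A \<star>\<^bsub>I\<^esub> (X \<star>\<^bsub>I\<^esub> A) = A" and "X \<star>\<^bsub>I\<^esub> (A \<star>\<^bsub>I\<^esub> X) = X"
proof -
  show "X \<in> tensors I" and XAA: "X \<star>\<^bsub>I\<^esub> (A \<star>\<^bsub>I\<^esub> A) = A" and AXX: "A \<star>\<^bsub>I\<^esub> (X \<star>\<^bsub>I\<^esub> X) = X"
    and "ctrans X \<star>\<^bsub>I\<^esub> ctrans A = A \<star>\<^bsub>I\<^esub> X"
    using assms by (auto simp: is_core_inverse_def)
  show "A \<star>\<^bsub>I\<^esub> (X \<star>\<^bsub>I\<^esub> A) = A" "X \<star>\<^bsub>I\<^esub> (A \<star>\<^bsub>I\<^esub> X) = X"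
    using XAA AXX by (metis einstein_assoc)+
qed

text \<open>\<open>A Y A = A\<close> gives \<open>(A Y) (A X) = A X\<close>, and conjugate
  transposition reverses the two Hermitian factors. As \<open>A X A = A\<close>, the reversed
  product is \<open>A Y\<close>, so \<open>A X = A Y\<close>. Then
  \<open>X = X A X = X A Y = X A^2 Y^2 = A Y^2 = Y\<close>.\<close>

lemma is_core_inverse_unique:
  assumes "is_core_inverse I A X" and "is_core_inverse I A Y"
  shows "X = Y"
proof -
  note X = is_core_inverseD[OF assms(1)] and Y = is_core_inverseD[OF assms(2)]
  have "ctrans ((A \<star>\<^bsub>I\<^esub> Y) \<star>\<^bsub>I\<^esub> (A \<star>\<^bsub>I\<^esub> X)) = ctrans (A \<star>\<^bsub>I\<^esub> X)"
    by (metis Y(5) einstein_assoc)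
  then have "(A \<star>\<^bsub>I\<^esub> X) \<star>\<^bsub>I\<^esub> (A \<star>\<^bsub>I\<^esub> Y) = A \<star>\<^bsub>I\<^esub> X"
    by (simp add: X(4) Y(4))
  then have AXY: "A \<star>\<^bsub>I\<^esub> X = A \<star>\<^bsub>I\<^esub> Y" by (metis X(5) einstein_assoc)
  have "X = X \<star>\<^bsub>I\<^esub> (A \<star>\<^bsub>I\<^esub> Y)" using X(6) AXY by simp
  also have "\<dots> = (X \<star>\<^bsub>I\<^esub> (A \<star>\<^bsub>I\<^esub> A)) \<star>\<^bsub>I\<^esub> (Y \<star>\<^bsub>I\<^esub> Y)" using Y(3) by (simp add: einstein_assoc)
  also have "\<dots> = Y" by (simp add: X(2) Y(3))
  finally show ?thesis .
qed

lemma core_inverse_eqI: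
  assumes A: "A \<in> tensors I" and X: "is_core_inverse I A X"
  shows "core_inverse I A = X"
  unfolding core_inverse_def
proof (rule the_equality)
  have *: "Y \<in> tensors I \<and> Y \<star>\<^bsub>I\<^esub> tpow I A 2 = A \<and> A \<star>\<^bsub>I\<^esub> tpow I Y 2 = Y \<and>
      ctrans (A \<star>\<^bsub>I\<^esub> Y) = A \<star>\<^bsub>I\<^esub> Y \<longleftrightarrow> is_core_inverse I A Y" for Y
    using A by (auto simp: is_core_inverse_def tpow_2)
  show "X \<in> tensors I \<and> X \<star>\<^bsub>I\<^esub> tpow I A 2 = A \<and> A \<star>\<^bsub>I\<^esub> tpow I X 2 = X \<and>
      ctrans (A \<star>\<^bsub>I\<^esub> X) = A \<star>\<^bsub>I\<^esub> X"
    using X by (simp only: *)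
  show "Y = X" if "Y \<in> tensors I \<and> Y \<star>\<^bsub>I\<^esub> tpow I A 2 = A \<and> A \<star>\<^bsub>I\<^esub> tpow I Y 2 = Y \<and>
      ctrans (A \<star>\<^bsub>I\<^esub> Y) = A \<star>\<^bsub>I\<^esub> Y" for Y
    using that is_core_inverse_unique[OF _ X] by (simp only: *)
qed

lemma core_tensor_imp_ex_core_inverse:
  assumes A: "A \<in> tensors I" and core: "core_tensor I A"
  shows "\<exists>X. is_core_inverse I A X"
proof -
  obtain W where W: "W \<in> tensors I" "A \<star>\<^bsub>I\<^esub> (A \<star>\<^bsub>I\<^esub> W) = A"
    using rshrank_eq_imp_factor[OF A A] core A by (auto simp: core_tensor_def tpow_2)
  obtain R where R: "R \<in> tensors I" "R \<star>\<^bsub>I\<^esub> (A \<star>\<^bsub>I\<^esub> A) = A"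
    using square_right_factor_imp_left_factor[OF A W] by blast
  obtain L where L: "L \<in> tensors I" "A \<star>\<^bsub>I\<^esub> (L \<star>\<^bsub>I\<^esub> A) = A" "ctrans (A \<star>\<^bsub>I\<^esub> L) = A \<star>\<^bsub>I\<^esub> L"
    using ex_hermitian_inner_inverse[OF A] by blast
  \<comment> \<open>\<open>R A = R (A^2 W) = (R A^2) W = A W\<close>.\<close>
  have RA: "R \<star>\<^bsub>I\<^esub> A = A \<star>\<^bsub>I\<^esub> W" by (metis R(2) W(2) einstein_assoc)
  define X where "X = R \<star>\<^bsub>I\<^esub> (A \<star>\<^bsub>I\<^esub> L)"
  have ARA: "A \<star>\<^bsub>I\<^esub> (R \<star>\<^bsub>I\<^esub> A) = A" by (simp add: RA W(2))
  have AX: "A \<star>\<^bsub>I\<^esub> X = A \<star>\<^bsub>I\<^esub> L" unfolding X_def by (metis ARA einstein_assoc)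
  have "X \<star>\<^bsub>I\<^esub> (A \<star>\<^bsub>I\<^esub> A) = A" unfolding X_def by (metis L(2) R(2) einstein_assoc)
  moreover have "A \<star>\<^bsub>I\<^esub> (X \<star>\<^bsub>I\<^esub> X) = X"
  proof -
    \<comment> \<open>With \<open>A\<close> as its leftmost factor, \<open>X\<close> is fixed by
      \<open>A L\<close>, because \<open>A L A = A\<close>.\<close>
    have X': "X = A \<star>\<^bsub>I\<^esub> (W \<star>\<^bsub>I\<^esub> L)" unfolding X_def by (metis RA einstein_assoc)
    have "A \<star>\<^bsub>I\<^esub> (X \<star>\<^bsub>I\<^esub> X) = (A \<star>\<^bsub>I\<^esub> L) \<star>\<^bsub>I\<^esub> X" by (metis AX einstein_assoc)
    also have "\<dots> = X" unfolding X' by (metis L(2) einstein_assoc)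
    finally show ?thesis .
  qed
  ultimately have "is_core_inverse I A X"
    using A R L by (simp only: is_core_inverse_def AX) (auto simp: X_def)
  then show ?thesis by blast
qed

text \<open>\<open>A = A^2 (X^2 A)\<close> bounds the rank of \<open>A\<close> by that of
  \<open>A^2\<close>; the reverse bound holds for every product.\<close>

lemma is_core_inverse_imp_core_tensor:
  assumes A: "A \<in> tensors I" and "is_core_inverse I A X"
  shows "core_tensor I A"
proof -
  note X = is_core_inverseD[OF assms(2)]
  have "(A \<star>\<^bsub>I\<^esub> A) \<star>\<^bsub>I\<^esub> (X \<star>\<^bsub>I\<^esub> (X \<star>\<^bsub>I\<^esub> A)) = A" by (metis X(3,5) einstein_assoc)
  then have "rshrank I A \<le> rshrank I (A \<star>\<^bsub>I\<^esub> A)" by (metis rshrank_einstein_le)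
  then show ?thesis
    using rshrank_einstein_le[of I A A] A by (simp add: core_tensor_def tpow_2)
qed

lemma is_core_inverse_core_inverse:
  assumes "A \<in> tensors I" and "core_tensor I A"
  shows "is_core_inverse I A (core_inverse I A)"
  using core_tensor_imp_ex_core_inverse[OF assms] core_inverse_eqI[OF assms(1)] by metis

section \<open>The core inverse of a sum\<close>

lemma is_core_inverse_add:
  assumes X: "is_core_inverse I A X" and Y: "is_core_inverse I B Y"
    and A: "A \<in> tensors I" and B: "B \<in> tensors I"
    and AB: "A \<star>\<^bsub>I\<^esub> B = 0" and AsB: "ctrans A \<star>\<^bsub>I\<^esub> B = 0"
  shows "is_core_inverse I (A + B) ((tid I - Y \<star>\<^bsub>I\<^esub> B) \<star>\<^bsub>I\<^esub> X + Y)"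
proof -
  note X = is_core_inverseD[OF X] and Y = is_core_inverseD[OF Y]
  define Z where "Z = (tid I - Y \<star>\<^bsub>I\<^esub> B) \<star>\<^bsub>I\<^esub> X + Y"
  have Z: "Z \<in> tensors I" using X Y B by (auto simp: Z_def)
  \<comment> \<open>\<open>Y = B Y^2\<close> lets \<open>A B = 0\<close> act.\<close>
  have AY: "A \<star>\<^bsub>I\<^esub> Y = 0" by (metis AB Y(3) einstein_assoc einstein_zero(1))
  have XB: "X \<star>\<^bsub>I\<^esub> B = 0"
  proof -
    \<comment> \<open>\<open>X = X (A X) = X (A X)^*\<close> exposes a factor \<open>A^*\<close> on
      the right, which annihilates \<open>B\<close>.\<close>
    have "X \<star>\<^bsub>I\<^esub> B = X \<star>\<^bsub>I\<^esub> ((ctrans X \<star>\<^bsub>I\<^esub> ctrans A) \<star>\<^bsub>I\<^esub> B)"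
      by (metis X(4,6) einstein_assoc)
    then show ?thesis by (simp add: einstein_assoc AsB)
  qed
  have BsA: "ctrans B \<star>\<^bsub>I\<^esub> A = 0" using arg_cong[OF AsB, of ctrans] by simp
  have YA: "Y \<star>\<^bsub>I\<^esub> A = 0"
  proof -
    have "Y \<star>\<^bsub>I\<^esub> A = Y \<star>\<^bsub>I\<^esub> ((ctrans Y \<star>\<^bsub>I\<^esub> ctrans B) \<star>\<^bsub>I\<^esub> A)"
      by (metis Y(4,6) einstein_assoc)
    then show ?thesis by (simp add: einstein_assoc BsA)
  qed
  have YX: "Y \<star>\<^bsub>I\<^esub> X = 0" by (metis YA X(3) einstein_assoc einstein_zero(1))
  \<comment> \<open>The trailing \<open>C\<close> lets these equations rewrite inside products
    nested to the right by \<open>einstein_assoc\<close>.\<close>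
  have BYB: "B \<star>\<^bsub>I\<^esub> (Y \<star>\<^bsub>I\<^esub> (B \<star>\<^bsub>I\<^esub> C)) = B \<star>\<^bsub>I\<^esub> C" for C by (metis Y(5) einstein_assoc)
  have BYY: "B \<star>\<^bsub>I\<^esub> (Y \<star>\<^bsub>I\<^esub> (Y \<star>\<^bsub>I\<^esub> C)) = Y \<star>\<^bsub>I\<^esub> C" for C by (metis Y(3) einstein_assoc)
  have AY': "A \<star>\<^bsub>I\<^esub> (Y \<star>\<^bsub>I\<^esub> C) = 0" and XB': "X \<star>\<^bsub>I\<^esub> (B \<star>\<^bsub>I\<^esub> C) = 0" for C
    by (metis AY XB einstein_assoc einstein_zero(1))+
  have XY: "X \<star>\<^bsub>I\<^esub> Y = 0" by (metis XB' Y(3))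
  have XY': "X \<star>\<^bsub>I\<^esub> (Y \<star>\<^bsub>I\<^esub> C) = 0" for C by (metis XY einstein_assoc einstein_zero(1))
  \<comment> \<open>The terms \<open>B X\<close> and \<open>B Y B X\<close> cancel by
    \<open>BYB\<close>.\<close>
  have SZ: "(A + B) \<star>\<^bsub>I\<^esub> Z = A \<star>\<^bsub>I\<^esub> X + B \<star>\<^bsub>I\<^esub> Y"
    using X(1) by (simp add: Z_def einstein_linear einstein_assoc AY AY' BYB)
  have ZS: "Z \<star>\<^bsub>I\<^esub> (A + B) = (tid I - Y \<star>\<^bsub>I\<^esub> B) \<star>\<^bsub>I\<^esub> (X \<star>\<^bsub>I\<^esub> A) + Y \<star>\<^bsub>I\<^esub> B"
    by (simp add: Z_def einstein_linear einstein_assoc XB YA)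
  \<comment> \<open>\<open>X A^2 = A\<close> turns the first summand of \<open>ZS\<close> into
    \<open>A - Y B A\<close>; the term \<open>Y B A\<close> from the second summand cancels, and
    \<open>Y B^2 = B\<close> remains.\<close>
  have "Z \<star>\<^bsub>I\<^esub> ((A + B) \<star>\<^bsub>I\<^esub> (A + B)) = A + B"
    using A X(1) unfolding einstein_assoc[symmetric] ZS
    by (simp add: einstein_linear einstein_assoc AB X(2) Y(2))
  moreover have "(A + B) \<star>\<^bsub>I\<^esub> (Z \<star>\<^bsub>I\<^esub> Z) = Z"
    unfolding einstein_assoc[symmetric] SZ using X(1)
    by (simp add: Z_def einstein_linear einstein_assoc X(3) Y(3) BYY YX XY XY')
  moreover have "ctrans ((A + B) \<star>\<^bsub>I\<^esub> Z) = (A + B) \<star>\<^bsub>I\<^esub> Z"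
    unfolding SZ by (simp add: X(4) Y(4))
  ultimately have "is_core_inverse I (A + B) Z" using Z by (simp only: is_core_inverse_def simp_thms)
  then show ?thesis by (simp only: Z_def)
qed

theorem theorem3p10:
  fixes I :: "nat list" and A B :: tensor
  assumes "I \<noteq> []" and "\<forall>d \<in> set I. 0 < d"
    and "A \<in> tensors I" and "B \<in> tensors I"
    and "core_tensor I A" and "core_tensor I B"
    and "A \<star>\<^bsub>I\<^esub> B = 0" and "ctrans A \<star>\<^bsub>I\<^esub> B = 0"
  shows "core_tensor I (A + B) \<and>
    core_inverse I (A + B)
      = (tid I - core_inverse I B \<star>\<^bsub>I\<^esub> B) \<star>\<^bsub>I\<^esub> core_inverse I A + core_inverse I B"
proof -
  have "is_core_inverse I (A + B)
      ((tid I - core_inverse I B \<star>\<^bsub>I\<^esub> B) \<star>\<^bsub>I\<^esub> core_inverse I A + core_inverse I B)"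
    using assms by (intro is_core_inverse_add is_core_inverse_core_inverse)
  moreover have "A + B \<in> tensors I" using assms by blast
  ultimately show ?thesis
    using is_core_inverse_imp_core_tensor core_inverse_eqI by blast
qed

end
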